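(* Let $N$, $i$, $j$ be non-negative integers and let $q$ be a variable. Then \begin{align*} P_{2N}(i,j,q) &= q^{2i^2-i+2j^2+j}\, (-q^2;q^2)_{N-i-j} \genfrac{[}{]}{0pt}{}{N}{i,\ j}_{q^4},\\ P_{2N+1}(i,j,q) &= q^{2i^2-i+2j^2+j}\, (-q^2;q^2)_{N-i-j+1} \genfrac{[}{]}{0pt}{}{N+1}{i,\ j}_{q^4}\,\frac{1-q^{2(N+i-j+1)}}{1-q^{4(N+1)}}. \end{align*}
   Context: A partition $\pi=(\lambda_1,\lambda_2,\dots)$ is a finite non-increasing sequence of positive integers (its parts); the empty sequence is the unique partition of $0$. The parts $\lambda_{2r-1}$ are odd-indexed and the parts $\lambda_{2r}$ even-indexed ($r\ge1$). For non-negative integers $N,i,j$, let $p_N(i,j,n)$ be the number of partitions of $n$ into distinct parts, all $\le N$, with exactly $i$ odd-indexed parts that are odd and exactly $j$ even-indexed parts that are odd, and $P_N(i,j,q)=\sum_{n\ge0}p_N(i,j,n)q^n$. Notation: $(a;q)_L=\prod_{n=0}^{L-1}(1-aq^n)$. With $(q)_k=(q;q)_k$, $\genfrac{[}{]}{0pt}{}{k}{n}_q=\frac{(q)_k}{(q)_n(q)_{k-n}}$ for $k\ge n\ge0$ and $0$ otherwise; $\genfrac{[}{]}{0pt}{}{k}{n,\ m}_q=\genfrac{[}{]}{0pt}{}{k}{n}_q\genfrac{[}{]}{0pt}{}{k-n}{m}_q$, which is $0$ if $n+m>k$; a right-hand side containing a vanishing $q$-trinomial coefficient is read as $0$. A subscript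 $q^4$ means $q$ is replaced by $q^4$. *)

theory Defs
  imports "HOL-Computational_Algebra.Formal_Power_Series"
begin

definition partition_of :: "nat \<Rightarrow> nat list \<Rightarrow> bool" where
  "partition_of n xs \<longleftrightarrow> sorted_wrt (\<ge>) xs \<and> (\<forall>x\<in>set xs. 0 < x) \<and> sum_list xs = n"

(* Parts are numbered from 1, list positions from 0: the part lambda_k is xs ! (k - 1). *)
definition odd_indexed_odd :: "nat list \<Rightarrow> nat" where
  "odd_indexed_odd xs = card {k. 1 \<le> k \<and> k \<le> length xs \<and> odd k \<and> odd (xs ! (k - 1))}"

definition even_indexed_odd :: "nat list \<Rightarrow> nat" where
  "even_indexed_odd xs = card {k. 1 \<le> k \<and> k \<le> length xs \<and> even k \<and> odd (xs ! (k - 1))}"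

definition dist_partitions :: "nat \<Rightarrow> nat \<Rightarrow> nat \<Rightarrow> nat \<Rightarrow> nat list set" where
  "dist_partitions N i j n =
     {xs. partition_of n xs \<and> distinct xs \<and> (\<forall>x\<in>set xs. x \<le> N)
        \<and> odd_indexed_odd xs = i \<and> even_indexed_odd xs = j}"

lemma finite_dist_partitions: "finite (dist_partitions N i j n)"
proof (rule finite_subset)
  show "dist_partitions N i j n \<subseteq> {xs. set xs \<subseteq> {..N} \<and> distinct xs}"
    by (auto simp: dist_partitions_def)
  show "finite {xs. set xs \<subseteq> {..N} \<and> distinct xs}"
    by (rule finite_subset_distinct) simp
qed

definition p_count :: "nat \<Rightarrow> nat \<Rightarrow> nat \<Rightarrow> nat \<Rightarrow> nat" where
  "p_count N i j n = card (dist_partitions N i j n)"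

definition P_gf :: "nat \<Rightarrow> nat \<Rightarrow> nat \<Rightarrow> rat fps" where
  "P_gf N i j = Abs_fps (\<lambda>n. of_nat (p_count N i j n))"

abbreviation qvar :: "rat fps" where
  "qvar \<equiv> fps_X"

definition qpoch :: "'a::comm_ring_1 \<Rightarrow> 'a \<Rightarrow> nat \<Rightarrow> 'a" where
  "qpoch a q L = (\<Prod>n<L. 1 - a * q ^ n)"

(* For q a positive power of fps_X the denominator has constant coefficient 1,
   so this is division by a unit of the power series ring. *)
definition qbinom :: "nat \<Rightarrow> nat \<Rightarrow> rat fps \<Rightarrow> rat fps" where
  "qbinom k n q =
     (if n \<le> k then qpoch q q k / (qpoch q q n * qpoch q q (k - n)) else 0)"

(* The truncated subtraction k - n is harmless: the first factor is 0 when n > k. *)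
definition qtrinom :: "nat \<Rightarrow> nat \<Rightarrow> nat \<Rightarrow> rat fps \<Rightarrow> rat fps" where
  "qtrinom k n m q = qbinom k n q * qbinom (k - n) m q"

lemma qtrinom_eq_0: "k < n + m \<Longrightarrow> qtrinom k n m q = 0"
  by (auto simp: qtrinom_def qbinom_def)

end

(* Deleting a largest part L from a partition shifts the remaining parts by one position and so
   exchanges the two index classes. Hence P_L(i,j) = P_{L-1}(i,j) + q^L P_{L-1}(j,i) for L even and
   P_L(i,j) = P_{L-1}(i,j) + q^L P_{L-1}(j,i-1) for L odd, and the closed forms satisfy the same
   recurrences. With M = N + 1 and k = M - i - j, for L = 2N + 2 and L = 2N + 1 these reduce to
   (1 - q^(2(M+i-j))) + q^(2(M+i-j)) (1 - q^(2(M+j-i))) = 1 - q^(4M) and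
   (1 - q^(2k)) + q^(2k) (1 - q^(4i)) = 1 - q^(2(M+i-j)). *)
theory Submission
  imports Defs
begin

section \<open>Deleting the largest part\<close>

text \<open>Position 1 is the head and every other position is the successor of a position in the
  tail. Keeping \<open>P\<close> general serves both index classes: for \<open>P\<close> =
  \<open>odd\<close> or \<open>even\<close>, the shift to \<open>P (Suc k)\<close> exchanges
  them.\<close>

lemma card_positions_Cons:
  "card {k. 1 \<le> k \<and> k \<le> length (x # xs) \<and> P k \<and> odd ((x # xs) ! (k - 1))} =
     (if P 1 \<and> odd x then 1 else 0) +
     card {k. 1 \<le> k \<and> k \<le> length xs \<and> P (Suc k) \<and> odd (xs ! (k - 1))}"
proof -
  let ?B = "{k. 1 \<le> k \<and> k \<le> length xs \<and> P (Suc k) \<and> odd (xs ! (k - 1))}"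
  let ?S = "{k::nat. k = 1 \<and> P 1 \<and> odd x}"
  have "{k. 1 \<le> k \<and> k \<le> length (x # xs) \<and> P k \<and> odd ((x # xs) ! (k - 1))} = ?S \<union> Suc ` ?B"
    (is "?L = ?R")
  proof (rule set_eqI)
    fix k
    show "k \<in> ?L \<longleftrightarrow> k \<in> ?R"
    proof (cases k)
      case 0
      then show ?thesis by auto
    next
      case (Suc m)
      then show ?thesis by (cases m) auto
    qed
  qed
  moreover have "finite ?B" by (rule finite_subset[of _ "{..length xs}"]) auto
  then have "card (?S \<union> Suc ` ?B) = card ?S + card (Suc ` ?B)"
    by (intro card_Un_disjoint finite_imageI) auto
  moreover have "card (Suc ` ?B) = card ?B" by (rule card_image) simp
  moreover have "card ?S = (if P 1 \<and> odd x then 1 else 0)" by simp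
  ultimately show ?thesis by (simp only:)
qed

lemma odd_indexed_odd_Cons:
  "odd_indexed_odd (x # xs) = (if odd x then 1 else 0) + even_indexed_odd xs"
  unfolding odd_indexed_odd_def even_indexed_odd_def card_positions_Cons by simp

lemma even_indexed_odd_Cons: "even_indexed_odd (x # xs) = odd_indexed_odd xs"
  unfolding odd_indexed_odd_def even_indexed_odd_def card_positions_Cons by simp

text \<open>Distinctness lowers the bound on the tail to \<open>N\<close>. Witnesses
  \<open>m\<close> and \<open>i'\<close> replace subtraction, so the cases with n < N + 1, or with
  an odd head and i = 0, are excluded without truncation.\<close>

lemma Cons_mem_dist_partitions_iff:
  "Suc N # ys \<in> dist_partitions (Suc N) i j n \<longleftrightarrow>
     (\<exists>m i'. n = Suc N + m \<and> i = (if odd (Suc N) then 1 else 0) + i' \<and> ys \<in> dist_partitions N j i' m)"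
  (is "?L \<longleftrightarrow> ?R")
proof -
  have "(\<forall>x\<in>set ys. x \<le> Suc N) \<and> Suc N \<notin> set ys \<longleftrightarrow> (\<forall>x\<in>set ys. x \<le> N)"
    by (metis le_Suc_eq not_less_eq_eq)
  moreover have "(\<forall>x\<in>set ys. x \<le> N) \<Longrightarrow> (\<forall>x\<in>set ys. x \<le> Suc N)" by auto
  ultimately show ?thesis
    unfolding dist_partitions_def partition_of_def
    by (auto simp: odd_indexed_odd_Cons even_indexed_odd_Cons)
qed

text \<open>Since parts do not increase, a head other than \<open>Suc N\<close> bounds every part by
  \<open>N\<close>.\<close>

lemma dist_partitions_Suc:
  "dist_partitions (Suc N) i j n =
     dist_partitions N i j n \<union> {Suc N # ys |ys. Suc N # ys \<in> dist_partitions (Suc N) i j n}"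
  (is "?L = ?R")
proof (rule set_eqI)
  fix xs
  show "xs \<in> ?L \<longleftrightarrow> xs \<in> ?R"
  proof (cases xs)
    case Nil
    then show ?thesis by (auto simp: dist_partitions_def)
  next
    case (Cons x ys)
    show ?thesis
    proof (cases "x = Suc N")
      case True
      then show ?thesis using Cons by (auto simp: dist_partitions_def)
    next
      case False
      then show ?thesis using Cons
        by (fastforce simp: dist_partitions_def partition_of_def)
    qed
  qed
qed

lemma p_count_Suc:
  "p_count (Suc N) i j n = p_count N i j n + card {ys. Suc N # ys \<in> dist_partitions (Suc N) i j n}"
proof -
  let ?B = "{ys. Suc N # ys \<in> dist_partitions (Suc N) i j n}"
  have eq: "dist_partitions (Suc N) i j n = dist_partitions N i j n \<union> Cons (Suc N) ` ?B"
    by (subst dist_partitions_Suc) auto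
  have "finite (Cons (Suc N) ` ?B)"
    by (rule finite_subset[OF _ finite_dist_partitions[of "Suc N" i j n]]) auto
  moreover have "dist_partitions N i j n \<inter> Cons (Suc N) ` ?B = {}"
    by (auto simp: dist_partitions_def)
  moreover have "card (Cons (Suc N) ` ?B) = card ?B" by (rule card_image) simp
  ultimately show ?thesis
    unfolding p_count_def by (subst eq) (simp only: card_Un_disjoint finite_dist_partitions)
qed

section \<open>Recurrences and initial value of the generating functions\<close>

lemma P_gf_Suc_even:
  assumes "even (Suc N)"
  shows "P_gf (Suc N) i j = P_gf N i j + qvar ^ Suc N * P_gf N j i"
proof (rule fps_ext)
  fix n
  have "card {ys. Suc N # ys \<in> dist_partitions (Suc N) i j n} =
      (if n < Suc N then 0 else p_count N j i (n - Suc N))"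
  proof (cases "n < Suc N")
    case True
    then show ?thesis by (simp only: Cons_mem_dist_partitions_iff) simp
  next
    case False
    then obtain m where n: "n = Suc N + m" using le_Suc_ex by (metis not_less)
    have "{ys. Suc N # ys \<in> dist_partitions (Suc N) i j n} = dist_partitions N j i m"
      using assms by (auto simp: Cons_mem_dist_partitions_iff n)
    then show ?thesis by (simp add: p_count_def n)
  qed
  then show "fps_nth (P_gf (Suc N) i j) n =
      fps_nth (P_gf N i j + qvar ^ Suc N * P_gf N j i) n"
    unfolding fps_add_nth fps_X_power_mult_nth by (simp add: P_gf_def p_count_Suc)
qed

text \<open>An odd largest part sits at position 1 and is itself counted by \<open>i\<close>, so
  none exists when i = 0; the \<open>if\<close> keeps \<open>i - 1\<close> from truncating.\<close>

lemma P_gf_Suc_odd: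
  assumes "odd (Suc N)"
  shows "P_gf (Suc N) i j =
    P_gf N i j + (if i = 0 then 0 else qvar ^ Suc N * P_gf N j (i - 1))"
proof (rule fps_ext)
  fix n
  have "card {ys. Suc N # ys \<in> dist_partitions (Suc N) i j n} =
      (if n < Suc N \<or> i = 0 then 0 else p_count N j (i - 1) (n - Suc N))"
  proof (cases "n < Suc N \<or> i = 0")
    case True
    then have "Suc N # ys \<notin> dist_partitions (Suc N) i j n" for ys
      using assms by (auto simp: Cons_mem_dist_partitions_iff)
    then show ?thesis using True by simp
  next
    case False
    then obtain m l where n: "n = Suc N + m" and i: "i = Suc l"
      using le_Suc_ex by (metis not_less not0_implies_Suc)
    have "{ys. Suc N # ys \<in> dist_partitions (Suc N) i j n} = dist_partitions N j l m"
      using assms by (auto simp: Cons_mem_dist_partitions_iff n i)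
    then show ?thesis by (simp add: p_count_def n i)
  qed
  then show "fps_nth (P_gf (Suc N) i j) n =
      fps_nth (P_gf N i j + (if i = 0 then 0 else qvar ^ Suc N * P_gf N j (i - 1))) n"
    by (cases "i = 0")
      (simp_all only: fps_add_nth fps_X_power_mult_nth if_False if_True refl,
       simp_all add: P_gf_def p_count_Suc)
qed

lemma P_gf_0: "P_gf 0 i j = (if i = 0 \<and> j = 0 then 1 else 0)"
proof (rule fps_ext)
  fix n
  have "dist_partitions 0 i j n = (if i = 0 \<and> j = 0 \<and> n = 0 then {[]} else {})"
  proof -
    have "xs = []" if "xs \<in> dist_partitions 0 i j n" for xs
      using that by (cases xs) (auto simp: dist_partitions_def partition_of_def)
    moreover have "[] \<in> dist_partitions 0 i j n \<longleftrightarrow> i = 0 \<and> j = 0 \<and> n = 0"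
      by (auto simp: dist_partitions_def partition_of_def odd_indexed_odd_def even_indexed_odd_def)
    ultimately show ?thesis by (auto split: if_splits)
  qed
  then show "fps_nth (P_gf 0 i j) n = fps_nth (if i = 0 \<and> j = 0 then 1 else 0) n"
    by (simp add: P_gf_def p_count_def)
qed

section \<open>The q-trinomial coefficients\<close>

lemma qpoch_0 [simp]: "qpoch a q 0 = 1"
  by (simp add: qpoch_def)

lemma qpoch_Suc: "qpoch a q (Suc n) = qpoch a q n * (1 - a * q ^ n)"
  by (simp add: qpoch_def)

text \<open>Constant coefficient 1 makes these products units, so the divisions in
  \<open>qbinom\<close> are exact and the denominators can be cancelled.\<close>

lemma fps_nth_qpoch_0:
  assumes "fps_nth q 0 = (0 :: rat)"
  shows "fps_nth (qpoch q q n) 0 = 1"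
  by (induction n) (simp_all add: qpoch_Suc assms)

lemma qpoch_self_nonzero:
  assumes "fps_nth q 0 = (0 :: rat)"
  shows "qpoch q q n \<noteq> 0"
  using fps_nth_qpoch_0[OF assms, of n] by (metis fps_zero_nth zero_neq_one)

lemma qbinom_mult:
  assumes q0: "fps_nth q 0 = (0 :: rat)" and "n \<le> k"
  shows "qbinom k n q * (qpoch q q n * qpoch q q (k - n)) = qpoch q q k"
proof -
  have "is_unit (qpoch q q n * qpoch q q (k - n))"
    by (simp add: fps_is_unit_iff fps_nth_qpoch_0[OF q0])
  then show ?thesis using \<open>n \<le> k\<close> by (simp add: qbinom_def unit_imp_dvd)
qed

text \<open>The factor \<open>qpoch q q (j + k)\<close> cancels between the two binomials, leaving a
  denominator symmetric in \<open>i\<close>, \<open>j\<close> and \<open>k\<close>.\<close>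

lemma qtrinom_mult:
  assumes q0: "fps_nth q 0 = (0 :: rat)"
  shows "qtrinom (i + j + k) i j q * (qpoch q q i * qpoch q q j * qpoch q q k) = qpoch q q (i + j + k)"
proof -
  have "qbinom (j + k) j q * (qpoch q q j * qpoch q q k) = qpoch q q (j + k)"
    using qbinom_mult[OF q0, of j "j + k"] by simp
  moreover have "qbinom (i + j + k) i q * (qpoch q q i * qpoch q q (j + k)) = qpoch q q (i + j + k)"
    using qbinom_mult[OF q0, of i "i + j + k"] by (simp add: add.assoc)
  moreover have "qtrinom (i + j + k) i j q = qbinom (i + j + k) i q * qbinom (j + k) j q"
    by (simp add: qtrinom_def add.assoc)
  ultimately show ?thesis by (metis (no_types, opaque_lifting) mult.assoc mult.left_commute)
qed

lemma qtrinom_commute: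
  assumes q0: "fps_nth q 0 = (0 :: rat)"
  shows "qtrinom n i j q = qtrinom n j i q"
proof (cases "i + j \<le> n")
  case True
  then obtain k where n: "n = i + j + k" using le_Suc_ex by blast
  have "qtrinom (i + j + k) i j q * (qpoch q q i * qpoch q q j * qpoch q q k) =
      qtrinom (i + j + k) j i q * (qpoch q q i * qpoch q q j * qpoch q q k)"
    using qtrinom_mult[OF q0, of i j k] qtrinom_mult[OF q0, of j i k] by (simp add: ac_simps)
  then show ?thesis using qpoch_self_nonzero[OF q0] by (simp add: n)
next
  case False
  then show ?thesis by (simp add: qtrinom_eq_0)
qed

text \<open>Here \<open>i\<close> and \<open>j\<close> stay fixed and the third index N - i - j
  grows with \<open>N\<close>. At i + j = N + 1 both sides vanish.\<close>

lemma qtrinom_step_remaining: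
  assumes q0: "fps_nth q 0 = (0 :: rat)" and "i + j \<le> Suc N"
  shows "(1 - q ^ Suc N) * qtrinom N i j q = (1 - q ^ (Suc N - i - j)) * qtrinom (Suc N) i j q"
proof (cases "i + j = Suc N")
  case True
  then show ?thesis by (simp add: qtrinom_eq_0)
next
  case False
  with assms have "i + j \<le> N" by simp
  then obtain k where N: "N = i + j + k" using le_Suc_ex by blast
  let ?D = "qpoch q q i * qpoch q q j * qpoch q q k"
  have A: "qtrinom (i + j + k) i j q * ?D = qpoch q q (i + j + k)"
    by (rule qtrinom_mult[OF q0])
  have B: "qtrinom (Suc (i + j + k)) i j q * ?D * (1 - q ^ Suc k) =
      qpoch q q (i + j + k) * (1 - q ^ Suc (i + j + k))"
    using qtrinom_mult[OF q0, of i j "Suc k"] by (simp add: qpoch_Suc mult.assoc)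
  have "(1 - q ^ Suc N) * qtrinom N i j q * ?D =
      (1 - q ^ (Suc N - i - j)) * qtrinom (Suc N) i j q * ?D"
  proof -
    have "(1 - q ^ Suc N) * qtrinom N i j q * ?D = (1 - q ^ Suc N) * qpoch q q (i + j + k)"
      by (simp only: A[unfolded mult.assoc] N mult.assoc)
    also have "\<dots> = (1 - q ^ Suc k) * qtrinom (Suc N) i j q * ?D"
      using B by (simp only: N mult_ac)
    also have "Suc k = Suc N - i - j" by (simp add: N)
    finally show ?thesis .
  qed
  then show ?thesis using qpoch_self_nonzero[OF q0] by simp
qed

text \<open>Here the third index stays fixed and the first grows with \<open>N\<close>, so the only
  new denominator factor is \<open>1 - q ^ Suc i\<close>.\<close>

lemma qtrinom_step_first:
  assumes q0: "fps_nth q 0 = (0 :: rat)" and "Suc i + j \<le> Suc N"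
  shows "(1 - q ^ Suc N) * qtrinom N i j q = (1 - q ^ Suc i) * qtrinom (Suc N) (Suc i) j q"
proof -
  obtain k where N: "N = i + j + k" using assms(2) le_Suc_ex by auto
  let ?D = "qpoch q q i * qpoch q q j * qpoch q q k"
  have A: "qtrinom (i + j + k) i j q * ?D = qpoch q q (i + j + k)"
    by (rule qtrinom_mult[OF q0])
  have B: "qtrinom (Suc (i + j + k)) (Suc i) j q * ?D * (1 - q ^ Suc i) =
      qpoch q q (i + j + k) * (1 - q ^ Suc (i + j + k))"
    using qtrinom_mult[OF q0, of "Suc i" j k] by (simp add: qpoch_Suc ac_simps)
  have "(1 - q ^ Suc N) * qtrinom N i j q * ?D = (1 - q ^ Suc N) * qpoch q q (i + j + k)"
    by (simp only: A[unfolded mult.assoc] N mult.assoc)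
  also have "\<dots> = (1 - q ^ Suc i) * qtrinom (Suc N) (Suc i) j q * ?D"
    using B by (simp only: N mult_ac)
  finally show ?thesis using qpoch_self_nonzero[OF q0] by simp
qed

section \<open>The closed forms satisfy the recurrences\<close>

definition even_rhs :: "nat \<Rightarrow> nat \<Rightarrow> nat \<Rightarrow> rat fps" where
  "even_rhs N i j = qvar ^ (2 * i ^ 2 - i + 2 * j ^ 2 + j)
     * qpoch (- (qvar ^ 2)) (qvar ^ 2) (N - i - j) * qtrinom N i j (qvar ^ 4)"

definition odd_rhs :: "nat \<Rightarrow> nat \<Rightarrow> nat \<Rightarrow> rat fps" where
  "odd_rhs N i j = qvar ^ (2 * i ^ 2 - i + 2 * j ^ 2 + j)
     * qpoch (- (qvar ^ 2)) (qvar ^ 2) (N + 1 - i - j) * qtrinom (N + 1) i j (qvar ^ 4)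
     * ((1 - qvar ^ (2 * (N + 1 + i - j))) / (1 - qvar ^ (4 * (N + 1))))"

lemma nth_qvar_pow4: "fps_nth (qvar ^ 4) 0 = 0"
  by simp

lemma one_minus_qvar_power_nonzero: "1 - qvar ^ (4 * (N + 1)) \<noteq> 0"
proof
  assume "1 - qvar ^ (4 * (N + 1)) = 0"
  then have "fps_nth (1 - qvar ^ (4 * (N + 1))) 0 = 0" by (simp only: fps_zero_nth)
  then show False by simp
qed

text \<open>Clearing the unit denominator reduces the recurrences to polynomial identities.\<close>

lemma odd_rhs_mult:
  "odd_rhs N i j * (1 - qvar ^ (4 * (N + 1))) =
     qvar ^ (2 * i ^ 2 - i + 2 * j ^ 2 + j)
     * qpoch (- (qvar ^ 2)) (qvar ^ 2) (N + 1 - i - j) * qtrinom (N + 1) i j (qvar ^ 4)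
     * (1 - qvar ^ (2 * (N + 1 + i - j)))"
proof -
  have "is_unit (1 - qvar ^ (4 * (N + 1)))" by (simp add: fps_is_unit_iff)
  then have "(1 - qvar ^ (2 * (N + 1 + i - j))) / (1 - qvar ^ (4 * (N + 1)))
      * (1 - qvar ^ (4 * (N + 1))) = 1 - qvar ^ (2 * (N + 1 + i - j))"
    using dvd_div_mult_self unit_imp_dvd by blast
  then show ?thesis unfolding odd_rhs_def by (simp only: mult.assoc)
qed

text \<open>As i \<le> 2 i^2, the subtraction never truncates; over the integers, exponents with
  \<open>i\<close> and \<open>j\<close> exchanged can be compared.\<close>

lemma int_exponent: "int (2 * i ^ 2 - i + 2 * j ^ 2 + j) = 2 * int i ^ 2 - int i + 2 * int j ^ 2 + int j"
proof -
  have "i \<le> 2 * i ^ 2" by (cases i) (simp_all add: power2_eq_square)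
  then show ?thesis by (simp add: of_nat_diff)
qed

lemma even_rhs_eq_0: "N < i + j \<Longrightarrow> even_rhs N i j = 0"
  by (simp add: even_rhs_def qtrinom_eq_0)

lemma odd_rhs_eq_0: "N + 1 < i + j \<Longrightarrow> odd_rhs N i j = 0"
  by (simp add: odd_rhs_def qtrinom_eq_0)

lemma even_rhs_Suc:
  "even_rhs (Suc N) i j = odd_rhs N i j + qvar ^ (2 * N + 2) * odd_rhs N j i"
proof (cases "i + j \<le> N + 1")
  case False
  then show ?thesis by (simp add: even_rhs_eq_0 odd_rhs_eq_0)
next
  case True
  define a b where "a = N + 1 + i - j" and "b = N + 1 + j - i"
  define E E' where "E = 2 * i ^ 2 - i + 2 * j ^ 2 + j" and "E' = 2 * j ^ 2 - j + 2 * i ^ 2 + i"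
  define p t where "p = qpoch (- (qvar ^ 2)) (qvar ^ 2) (N + 1 - i - j)"
    and "t = qtrinom (N + 1) i j (qvar ^ 4)"
  \<comment> \<open>Exchanging \<open>i\<close> and \<open>j\<close> changes the exponent by E' - E
    = 2(i - j).\<close>
  have "int (E' + (2 * N + 2)) = int (E + 2 * a)"
    using int_exponent[of i j, folded E_def] int_exponent[of j i, folded E'_def] True
    by (simp add: a_def of_nat_diff)
  then have e1: "qvar ^ (2 * N + 2) * qvar ^ E' = qvar ^ E * qvar ^ (2 * a)"
    by (metis add.commute of_nat_eq_iff power_add)
  have "4 * (N + 1) = 2 * a + 2 * b" using True by (simp add: a_def b_def)
  then have e2: "qvar ^ (4 * (N + 1)) = qvar ^ (2 * a) * qvar ^ (2 * b)"
    by (simp only: power_add)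
  have r1: "odd_rhs N i j * (1 - qvar ^ (4 * (N + 1))) = qvar ^ E * p * t * (1 - qvar ^ (2 * a))"
    unfolding odd_rhs_mult by (simp only: a_def E_def p_def t_def)
  have r2: "odd_rhs N j i * (1 - qvar ^ (4 * (N + 1))) = qvar ^ E' * p * t * (1 - qvar ^ (2 * b))"
    unfolding odd_rhs_mult qtrinom_commute[OF nth_qvar_pow4, of _ j i]
    by (simp only: b_def E'_def p_def t_def diff_commute[of "N + 1" j i])
  have r0: "even_rhs (Suc N) i j = qvar ^ E * p * t"
    by (simp add: even_rhs_def E_def p_def t_def)
  \<comment> \<open>Used with u = q^(2a) and v = q^(2b), where a + b = 2(N + 1): the sum (1 - u) +
    u(1 - v) telescopes to 1 - uv.\<close>
  have ring: "x * p * t * (1 - u) + x * u * p * t * (1 - v) = x * p * t * (1 - u * v)"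
    for x u v :: "rat fps"
    by (simp add: algebra_simps)
  have "(odd_rhs N i j + qvar ^ (2 * N + 2) * odd_rhs N j i) * (1 - qvar ^ (4 * (N + 1))) =
      qvar ^ E * p * t * (1 - qvar ^ (2 * a)) +
      (qvar ^ (2 * N + 2) * qvar ^ E') * p * t * (1 - qvar ^ (2 * b))"
    by (simp only: distrib_right mult.assoc r1[unfolded mult.assoc] r2[unfolded mult.assoc])
  also have "\<dots> = even_rhs (Suc N) i j * (1 - qvar ^ (4 * (N + 1)))"
    unfolding e1 e2 r0 by (rule ring)
  finally show ?thesis using mult_right_cancel[OF one_minus_qvar_power_nonzero] by metis
qed

text \<open>After multiplication by \<open>d\<close>, the three terms are q^E p t times 1 - uw, 1 -
  u and u(1 - w), where u = q^(2k) and w = q^(4i).\<close>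

lemma odd_rhs_step:
  "odd_rhs N i j =
     even_rhs N i j + (if i = 0 then 0 else qvar ^ (2 * N + 1) * even_rhs N j (i - 1))"
proof (cases "i + j \<le> N + 1")
  case False
  then show ?thesis by (auto simp: even_rhs_eq_0 odd_rhs_eq_0)
next
  case True
  define k where "k = N + 1 - i - j"
  define E where "E = 2 * i ^ 2 - i + 2 * j ^ 2 + j"
  define p t where "p = qpoch (- (qvar ^ 2)) (qvar ^ 2) k"
    and "t = qtrinom (N + 1) i j (qvar ^ 4)"
  define d where "d = 1 - qvar ^ (4 * (N + 1))"
  have d: "d = 1 - (qvar ^ 4) ^ Suc N"
    by (simp only: d_def power_mult[symmetric] Suc_eq_plus1)
  have "2 * (N + 1 + i - j) = 2 * k + 4 * i" using True by (simp add: k_def)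
  then have lhs: "odd_rhs N i j * d = qvar ^ E * p * t * (1 - qvar ^ (2 * k) * qvar ^ (4 * i))"
    unfolding d_def odd_rhs_mult by (simp only: E_def p_def k_def t_def power_add)
  have first: "even_rhs N i j * d = qvar ^ E * p * t * (1 - qvar ^ (2 * k))"
  proof -
    have tri: "d * qtrinom N i j (qvar ^ 4) = (1 - qvar ^ (4 * k)) * t"
      using qtrinom_step_remaining[OF nth_qvar_pow4, of i j N] True
      by (simp add: d k_def t_def power_mult)
    \<comment> \<open>For k > 0 the product on the left lacks the last factor 1 + q^(2k) of
      \<open>p\<close>, which 1 - q^(4k) supplies. For k = 0 the length truncates to 0, but both
      sides vanish.\<close>
    have poch: "qpoch (- (qvar ^ 2)) (qvar ^ 2) (N - i - j) * (1 - qvar ^ (4 * k)) =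
        p * (1 - qvar ^ (2 * k))"
    proof (cases k)
      case 0
      then show ?thesis by simp
    next
      case (Suc m)
      then have "N - i - j = m" using True by (simp add: k_def)
      moreover have "p = qpoch (- (qvar ^ 2)) (qvar ^ 2) m * (1 + qvar ^ (2 * k))"
        unfolding p_def Suc qpoch_Suc by (simp add: power_add power_mult power2_eq_square)
      moreover have "1 - qvar ^ (4 * k) = (1 + qvar ^ (2 * k)) * (1 - qvar ^ (2 * k))"
        by (simp add: algebra_simps flip: power_add)
      ultimately show ?thesis by (simp only: mult.assoc)
    qed
    have "even_rhs N i j * d =
        qvar ^ E * qpoch (- (qvar ^ 2)) (qvar ^ 2) (N - i - j) * (d * qtrinom N i j (qvar ^ 4))"
      by (simp only: even_rhs_def E_def mult_ac)
    also have "\<dots> = qvar ^ E * (qpoch (- (qvar ^ 2)) (qvar ^ 2) (N - i - j) * (1 - qvar ^ (4 * k))) * t"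
      by (simp only: tri mult_ac)
    also have "\<dots> = qvar ^ E * p * t * (1 - qvar ^ (2 * k))"
      unfolding poch by (simp only: mult_ac)
    finally show ?thesis .
  qed
  have second: "(if i = 0 then 0 else qvar ^ (2 * N + 1) * even_rhs N j (i - 1)) * d =
      qvar ^ E * p * t * (qvar ^ (2 * k) * (1 - qvar ^ (4 * i)))"
  proof (cases i)
    case 0
    then show ?thesis by simp
  next
    case (Suc l)
    define E' where "E' = 2 * j ^ 2 - j + 2 * l ^ 2 + l"
    \<comment> \<open>With i = l + 1, E - E' = 2l + 2j + 1 and 2k = 2N - 2l - 2j.\<close>
    have "int (E' + (2 * N + 1)) = int (E + 2 * k)"
      using int_exponent[of i j, folded E_def] int_exponent[of j l, folded E'_def] True
      by (simp add: k_def of_nat_diff Suc power2_eq_square algebra_simps)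
    then have e: "qvar ^ (2 * N + 1) * qvar ^ E' = qvar ^ E * qvar ^ (2 * k)"
      by (metis add.commute of_nat_eq_iff power_add)
    \<comment> \<open>Both N + 1 and \<open>i\<close> drop by 1, so the Pochhammer product is again
      \<open>p\<close>.\<close>
    have k: "N - j - l = k" using True by (simp add: k_def Suc)
    have tri: "d * qtrinom N j l (qvar ^ 4) = (1 - qvar ^ (4 * i)) * t"
      using qtrinom_step_first[OF nth_qvar_pow4, of l j N] True
      unfolding qtrinom_commute[OF nth_qvar_pow4, of N j l]
      by (simp only: d Suc t_def Suc_eq_plus1 power_mult)
    have "qvar ^ (2 * N + 1) * even_rhs N j l * d =
        (qvar ^ (2 * N + 1) * qvar ^ E') * p * (d * qtrinom N j l (qvar ^ 4))"
      by (simp only: even_rhs_def k E'_def p_def mult_ac)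
    also have "\<dots> = qvar ^ E * p * t * (qvar ^ (2 * k) * (1 - qvar ^ (4 * i)))"
      unfolding e tri by (simp only: mult_ac)
    finally show ?thesis by (simp add: Suc)
  qed
  have "odd_rhs N i j * d =
      (even_rhs N i j + (if i = 0 then 0 else qvar ^ (2 * N + 1) * even_rhs N j (i - 1))) * d"
    unfolding distrib_right first second lhs by (simp only: algebra_simps) simp
  then show ?thesis
    unfolding d_def using mult_right_cancel[OF one_minus_qvar_power_nonzero] by metis
qed

section \<open>Initial value and induction on the bound\<close>

lemma even_rhs_0: "even_rhs 0 i j = (if i = 0 \<and> j = 0 then 1 else 0)"
  by (cases "i = 0 \<and> j = 0") (auto simp: even_rhs_def qtrinom_eq_0, simp add: qtrinom_def qbinom_def)

text \<open>The even bound 2N yields the odd bound 2N + 1, which yields 2N + 2. Each step exchanges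
  \<open>i\<close> and \<open>j\<close>, so the induction hypothesis must cover all pairs.\<close>

lemma P_gf_closed_form: "P_gf (2 * N) i j = even_rhs N i j \<and> P_gf (2 * N + 1) i j = odd_rhs N i j"
proof -
  have odd: "P_gf (2 * N + 1) i j = odd_rhs N i j" if "\<And>i j. P_gf (2 * N) i j = even_rhs N i j" for N i j
    using P_gf_Suc_odd[of "2 * N" i j] by (simp add: that odd_rhs_step)
  have even: "P_gf (2 * N) i j = even_rhs N i j" for N i j
  proof (induction N arbitrary: i j)
    case 0
    show ?case by (simp add: P_gf_0 even_rhs_0)
  next
    case (Suc N)
    then show ?case
      using P_gf_Suc_even[of "2 * N + 1" i j] odd[of N] by (simp add: even_rhs_Suc)
  qed
  show ?thesis using even odd by blast
qed

(* The natural-number subtractions involving N truncate only when the q-trinomial coefficient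
   is 0 (qtrinom_eq_0), in which case the whole right-hand side is 0. *)
theorem theorem2p1:
  fixes N i j :: nat
  shows "P_gf (2 * N) i j =
           qvar ^ (2 * i ^ 2 - i + 2 * j ^ 2 + j)
             * qpoch (- (qvar ^ 2)) (qvar ^ 2) (N - i - j)
             * qtrinom N i j (qvar ^ 4)
       \<and> P_gf (2 * N + 1) i j =
           qvar ^ (2 * i ^ 2 - i + 2 * j ^ 2 + j)
             * qpoch (- (qvar ^ 2)) (qvar ^ 2) (N + 1 - i - j)
             * qtrinom (N + 1) i j (qvar ^ 4)
             * ((1 - qvar ^ (2 * (N + 1 + i - j))) / (1 - qvar ^ (4 * (N + 1))))"
  using P_gf_closed_form[of N i j] unfolding even_rhs_def odd_rhs_def .

end
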